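(* Let $\Sigma(A,B,B^* )$, with $Bu=bu$, be a minimal collocated self-adjoint system on a Hilbert space $\mathcal Z$ with $A$ negative semi-definite and $b\in D((-A)^{1/2})$. Denote its invariant zeros by $\{\mu_n\}$. Then for any $\varepsilon>0$ there is $N\in\mathbb N$ such that for every $n\ge N$, $|\mu_n-\lambda|<\varepsilon$ for some eigenvalue $\lambda$ of $A$.
   Context: $\mathcal Z$ is a complex Hilbert space. A system $\Sigma(A,B,C)$ consists of the generator $A:D(A)\subset\mathcal Z\to\mathcal Z$ of a $C_0$-semigroup on $\mathcal Z$ and bounded operators $B:\mathbb C\to\mathcal Z$, $Bu=bu$, and $C:\mathcal Z\to\mathbb C$, $Cx=\langle x,c\rangle$, with $b,c\in\mathcal Z$ and $B,C\neq0$. Standing assumption: $\sigma(A)$ is non-empty and consists only of isolated eigenvalues with finite algebraic multiplicity. The system is collocated self-adjoint if $A$ is self-adjoint and $C=B^*$ (i.e. $c=b$). $A$ is negative semi-definite if $\langle Az,z\rangle\le0$ for every $z\in D(A)$. An invariant zero is a $\lambda\in\mathbb C$ for which there are a non-zero $x\in D(A)$ and a scalar $u$ with $(\lambda I-A)x-Bu=0$ and $Cx=0$. The system is minimal if no invariant zero belongs to $\sigma(A)$. For a minimal system the set of invariant zeros is countable with no finite accumulation point, and $\{\mu_n\}$ is an enumeration of it. *)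

theory Defs
  imports "HOL-Analysis.Analysis"
begin

class scaleC =
  fixes scaleC :: "complex \<Rightarrow> 'a \<Rightarrow> 'a"  (infixr "*\<^sub>C" 75)

text \<open>The inner product is linear in the first argument and conjugate-linear in the second.\<close>

class complex_inner = real_normed_vector + scaleC +
  fixes cinner :: "'a \<Rightarrow> 'a \<Rightarrow> complex"
  assumes scaleC_add_right: "a *\<^sub>C (x + y) = a *\<^sub>C x + a *\<^sub>C y"
    and scaleC_add_left: "(a + b) *\<^sub>C x = a *\<^sub>C x + b *\<^sub>C x"
    and scaleC_scaleC: "a *\<^sub>C b *\<^sub>C x = (a * b) *\<^sub>C x"
    and scaleR_scaleC: "r *\<^sub>R x = complex_of_real r *\<^sub>C x"
    and cinner_commute: "cinner x y = cnj (cinner y x)"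
    and cinner_add_left: "cinner (x + y) z = cinner x z + cinner y z"
    and cinner_scaleC_left: "cinner (a *\<^sub>C x) y = a * cinner x y"
    and cinner_ge_zero: "0 \<le> Re (cinner x x)"
    and norm_eq_sqrt_cinner: "norm x = sqrt (Re (cinner x x))"

class chilbert_space = complex_inner + complete_space

lemma vector_space_scaleC: "vector_space (scaleC :: complex \<Rightarrow> 'a \<Rightarrow> 'a::complex_inner)"
proof
  fix x :: 'a
  show "1 *\<^sub>C x = x"
    using scaleR_scaleC[of 1 x] by simp
qed (simp_all add: scaleC_add_right scaleC_add_left scaleC_scaleC)

definition bounded_clinear ::
    "('a::complex_inner \<Rightarrow> 'b::complex_inner) \<Rightarrow> bool" where
  "bounded_clinear f \<longleftrightarrow> bounded_linear f \<and> (\<forall>a x. f (a *\<^sub>C x) = a *\<^sub>C f x)"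

text \<open>
  An unbounded operator is given by its domain \<open>D\<close> and a function \<open>A\<close>, of which only the
  values on \<open>D\<close> matter.
\<close>

definition linear_operator :: "'a::complex_inner set \<Rightarrow> ('a \<Rightarrow> 'a) \<Rightarrow> bool" where
  "linear_operator D A \<longleftrightarrow>
     0 \<in> D \<and>
     (\<forall>x\<in>D. \<forall>y\<in>D. x + y \<in> D \<and> A (x + y) = A x + A y) \<and>
     (\<forall>a. \<forall>x\<in>D. a *\<^sub>C x \<in> D \<and> A (a *\<^sub>C x) = a *\<^sub>C A x)"

text \<open>\<open>T t\<close> matters only for \<open>t \<ge> 0\<close>.\<close>

definition C0_semigroup :: "(real \<Rightarrow> 'a::chilbert_space \<Rightarrow> 'a) \<Rightarrow> bool" where
  "C0_semigroup T \<longleftrightarrow>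
     (\<forall>t\<ge>0. bounded_clinear (T t)) \<and>
     (\<forall>x. T 0 x = x) \<and>
     (\<forall>s\<ge>0. \<forall>t\<ge>0. \<forall>x. T (s + t) x = T s (T t x)) \<and>
     (\<forall>x. ((\<lambda>t. T t x) \<longlongrightarrow> x) (at_right 0))"

definition has_generator ::
    "(real \<Rightarrow> 'a::chilbert_space \<Rightarrow> 'a) \<Rightarrow> 'a set \<Rightarrow> ('a \<Rightarrow> 'a) \<Rightarrow> bool" where
  "has_generator T D A \<longleftrightarrow>
     D = {x. \<exists>y. ((\<lambda>t. (1 / t) *\<^sub>R (T t x - x)) \<longlongrightarrow> y) (at_right 0)} \<and>
     (\<forall>x\<in>D. ((\<lambda>t. (1 / t) *\<^sub>R (T t x - x)) \<longlongrightarrow> A x) (at_right 0))"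

definition generates_C0_semigroup :: "'a::chilbert_space set \<Rightarrow> ('a \<Rightarrow> 'a) \<Rightarrow> bool" where
  "generates_C0_semigroup D A \<longleftrightarrow> (\<exists>T. C0_semigroup T \<and> has_generator T D A)"

definition resolvent_set :: "'a::chilbert_space set \<Rightarrow> ('a \<Rightarrow> 'a) \<Rightarrow> complex set" where
  "resolvent_set D A =
     {l. \<exists>R. bounded_clinear R \<and>
             (\<forall>y. R y \<in> D \<and> l *\<^sub>C R y - A (R y) = y) \<and>
             (\<forall>x\<in>D. R (l *\<^sub>C x - A x) = x)}"

definition spectrum :: "'a::chilbert_space set \<Rightarrow> ('a \<Rightarrow> 'a) \<Rightarrow> complex set" where
  "spectrum D A = - resolvent_set D A"

definition eigenvalue :: "'a::complex_inner set \<Rightarrow> ('a \<Rightarrow> 'a) \<Rightarrow> complex \<Rightarrow> bool" where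
  "eigenvalue D A l \<longleftrightarrow> (\<exists>x\<in>D. x \<noteq> 0 \<and> A x = l *\<^sub>C x)"

text \<open>\<open>pow_kernel D A l k\<close> is the kernel of \<open>(l I - A)\<^sup>k\<close> on its natural domain.\<close>

primrec pow_kernel ::
    "'a::complex_inner set \<Rightarrow> ('a \<Rightarrow> 'a) \<Rightarrow> complex \<Rightarrow> nat \<Rightarrow> 'a set" where
  "pow_kernel D A l 0 = {0}"
| "pow_kernel D A l (Suc k) = {x \<in> D. l *\<^sub>C x - A x \<in> pow_kernel D A l k}"

text \<open>
  The algebraic multiplicity of \<open>l\<close> is the complex dimension of its generalised eigenspace.
\<close>

definition finite_algebraic_multiplicity ::
    "'a::complex_inner set \<Rightarrow> ('a \<Rightarrow> 'a) \<Rightarrow> complex \<Rightarrow> bool" where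
  "finite_algebraic_multiplicity D A l \<longleftrightarrow>
     (\<exists>F. finite F \<and> (\<Union>k. pow_kernel D A l k) \<subseteq> module.span scaleC F)"

definition input_op :: "'a::complex_inner \<Rightarrow> complex \<Rightarrow> 'a" where
  "input_op b u = u *\<^sub>C b"

definition output_op :: "'a::complex_inner \<Rightarrow> 'a \<Rightarrow> complex" where
  "output_op c x = cinner x c"

definition control_system ::
    "'a::chilbert_space set \<Rightarrow> ('a \<Rightarrow> 'a) \<Rightarrow> 'a \<Rightarrow> 'a \<Rightarrow> bool" where
  "control_system D A b c \<longleftrightarrow>
     generates_C0_semigroup D A \<and>
     input_op b \<noteq> (\<lambda>_. 0) \<and> output_op c \<noteq> (\<lambda>_. 0) \<and>
     spectrum D A \<noteq> {} \<and>
     (\<forall>l \<in> spectrum D A. l isolated_in spectrum D A \<and> eigenvalue D A l \<and>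
        finite_algebraic_multiplicity D A l)"

definition invariant_zeros ::
    "'a::complex_inner set \<Rightarrow> ('a \<Rightarrow> 'a) \<Rightarrow> 'a \<Rightarrow> 'a \<Rightarrow> complex set" where
  "invariant_zeros D A b c =
     {l. \<exists>x\<in>D. x \<noteq> 0 \<and> (\<exists>u. l *\<^sub>C x - A x - input_op b u = 0 \<and> output_op c x = 0)}"

definition minimal_system ::
    "'a::chilbert_space set \<Rightarrow> ('a \<Rightarrow> 'a) \<Rightarrow> 'a \<Rightarrow> 'a \<Rightarrow> bool" where
  "minimal_system D A b c \<longleftrightarrow> invariant_zeros D A b c \<inter> spectrum D A = {}"

text \<open>The adjoint as a graph; it is single-valued when \<open>D\<close> is dense.\<close>

definition adjoint_graph ::
    "'a::complex_inner set \<Rightarrow> ('a \<Rightarrow> 'a) \<Rightarrow> ('a \<times> 'a) set" where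
  "adjoint_graph D A = {(y, z). \<forall>x\<in>D. cinner (A x) y = cinner x z}"

definition self_adjoint :: "'a::complex_inner set \<Rightarrow> ('a \<Rightarrow> 'a) \<Rightarrow> bool" where
  "self_adjoint D A \<longleftrightarrow>
     linear_operator D A \<and> closure D = UNIV \<and> adjoint_graph D A = (\<lambda>x. (x, A x)) ` D"

definition positive_semidefinite ::
    "'a::complex_inner set \<Rightarrow> ('a \<Rightarrow> 'a) \<Rightarrow> bool" where
  "positive_semidefinite D A \<longleftrightarrow>
     (\<forall>x\<in>D. cinner (A x) x \<in> \<real> \<and> Re (cinner (A x) x) \<ge> 0)"

definition negative_semidefinite ::
    "'a::complex_inner set \<Rightarrow> ('a \<Rightarrow> 'a) \<Rightarrow> bool" where
  "negative_semidefinite D A \<longleftrightarrow>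
     (\<forall>x\<in>D. cinner (A x) x \<in> \<real> \<and> Re (cinner (A x) x) \<le> 0)"

text \<open>
  \<open>S\<close> with domain \<open>E\<close> is the positive semi-definite self-adjoint square root of \<open>P\<close> with
  domain \<open>D\<close>; the domain of \<open>S\<^sup>2\<close> has to be exactly \<open>D\<close>.
\<close>

definition positive_sqrt ::
    "'a::complex_inner set \<Rightarrow> ('a \<Rightarrow> 'a) \<Rightarrow> 'a set \<Rightarrow> ('a \<Rightarrow> 'a) \<Rightarrow> bool" where
  "positive_sqrt D P E S \<longleftrightarrow>
     self_adjoint E S \<and> positive_semidefinite E S \<and>
     D = {x \<in> E. S x \<in> E} \<and> (\<forall>x\<in>D. S (S x) = P x)"

text \<open>
  For positive semi-definite self-adjoint \<open>P\<close> the square root exists and is unique, so this is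
  the domain of \<open>P\<^sup>1\<^sup>/\<^sup>2\<close>.
\<close>

definition sqrt_domain :: "'a::complex_inner set \<Rightarrow> ('a \<Rightarrow> 'a) \<Rightarrow> 'a set" where
  "sqrt_domain D P = {x. \<exists>E S. positive_sqrt D P E S \<and> x \<in> E}"

definition collocated_self_adjoint ::
    "'a::complex_inner set \<Rightarrow> ('a \<Rightarrow> 'a) \<Rightarrow> 'a \<Rightarrow> 'a \<Rightarrow> bool" where
  "collocated_self_adjoint D A b c \<longleftrightarrow> self_adjoint D A \<and> c = b"

end

theory Submission
  imports Defs
begin

text \<open>
  A zero \<open>\<mu>\<close> at distance at least \<open>\<epsilon>\<close> from the spectrum comes with a vector \<open>x\<close> such that
  \<open>(\<mu> - A) x = b\<close> and \<open>\<langle>x, b\<rangle> = 0\<close>; pairing with \<open>x\<close> shows that \<open>\<mu>\<close> is real. The vectors of two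
  distinct zeros are orthogonal, and \<open>(\<mu>\<^sub>1 - A) (x\<^sub>1 - x\<^sub>2) = (\<mu>\<^sub>2 - \<mu>\<^sub>1) x\<^sub>2\<close>, so the resolvent
  bound \<open>\<parallel>(\<mu>\<^sub>1 - A)\<^sup>-\<^sup>1\<parallel> \<le> 1 / \<epsilon>\<close> forces \<open>\<bar>\<mu>\<^sub>1 - \<mu>\<^sub>2\<bar> \<ge> \<epsilon>\<close>. With \<open>S = (-A)\<^sup>1\<^sup>/\<^sup>2\<close> and \<open>y = S b\<close>,
  the vector \<open>w = S x\<close> satisfies \<open>(\<mu> - A) w = y\<close> and \<open>\<langle>w, y\<rangle> = \<parallel>b\<parallel>\<^sup>2\<close>. As the resolvents are
  uniformly bounded and \<open>D\<close> is dense, \<open>\<langle>(\<mu> - A)\<^sup>-\<^sup>1 y, y\<rangle>\<close> tends to \<open>0\<close> for large \<open>\<bar>\<mu>\<bar>\<close>, so these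
  zeros are bounded. A bounded \<open>\<epsilon>\<close>-separated set is finite.
\<close>

section \<open>Identities for the complex inner product and its norm\<close>

lemma cinner_add_right: "cinner x (y + z) = cinner x y + cinner x (z::'a::complex_inner)"
  by (metis cinner_add_left cinner_commute complex_cnj_add)

lemma cinner_scaleR_left: "cinner (r *\<^sub>R x) y = of_real r * cinner x (y::'a::complex_inner)"
  by (simp add: scaleR_scaleC cinner_scaleC_left)

lemma cinner_scaleR_right: "cinner x (r *\<^sub>R y) = of_real r * cinner x (y::'a::complex_inner)"
  by (metis cinner_commute cinner_scaleR_left complex_cnj_mult complex_cnj_complex_of_real)

lemma cinner_diff_left: "cinner (x - y) z = cinner x z - cinner y (z::'a::complex_inner)"
  using cinner_add_left[of "x - y" y z] by simp

lemma cinner_diff_right: "cinner x (y - z) = cinner x y - cinner x (z::'a::complex_inner)"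
  using cinner_add_right[of x "y - z" z] by simp

lemma cinner_minus_left: "cinner (- x) y = - cinner x (y::'a::complex_inner)"
  using cinner_scaleR_left[of "-1" x y] by simp

lemma cinner_self: "cinner x x = of_real ((norm (x::'a::complex_inner))\<^sup>2)"
proof (rule complex_eqI)
  show "Re (cinner x x) = Re (of_real ((norm x)\<^sup>2))"
    by (simp add: norm_eq_sqrt_cinner cinner_ge_zero)
  show "Im (cinner x x) = Im (of_real ((norm x)\<^sup>2))"
    using arg_cong[OF cinner_commute[of x x], of Im] by simp
qed

lemma Re_cinner_commute: "Re (cinner x y) = Re (cinner y (x::'a::complex_inner))"
  by (subst cinner_commute) simp

lemma norm_add_power2:
  "(norm (x + y))\<^sup>2 = (norm x)\<^sup>2 + 2 * Re (cinner x y) + (norm (y::'a::complex_inner))\<^sup>2"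
proof -
  have "(norm (x + y))\<^sup>2 = Re (cinner (x + y) (x + y))"
    by (simp add: cinner_self)
  then show ?thesis
    using Re_cinner_commute[of y x] unfolding cinner_add_left cinner_add_right
    by (simp add: cinner_self)
qed

lemma norm_diff_power2:
  "(norm (x - y))\<^sup>2 = (norm x)\<^sup>2 - 2 * Re (cinner x y) + (norm (y::'a::complex_inner))\<^sup>2"
proof -
  have "(norm (x - y))\<^sup>2 = Re (cinner (x - y) (x - y))"
    by (simp add: cinner_self)
  then show ?thesis
    using Re_cinner_commute[of y x] unfolding cinner_diff_left cinner_diff_right
    by (simp add: cinner_self)
qed

lemma Re_cinner_le: "Re (cinner x y) \<le> norm x * norm (y::'a::complex_inner)"
proof -
  have "(norm (x + y))\<^sup>2 \<le> (norm x + norm y)\<^sup>2"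
    by (rule power_mono) (auto simp: norm_triangle_ineq)
  then show ?thesis
    by (simp add: norm_add_power2 power2_sum)
qed

section \<open>Linear operators on a domain and symmetry\<close>

lemma linear_operator_diff:
  assumes "linear_operator D A" "x \<in> D" "y \<in> D"
  shows "x - y \<in> D" "A (x - y) = A x - A y"
proof -
  have m: "(-1) *\<^sub>R y \<in> D \<and> A ((-1) *\<^sub>R y) = (-1) *\<^sub>R A y"
    using assms(1,3) unfolding linear_operator_def scaleR_scaleC by blast
  then have "x + (-1) *\<^sub>R y \<in> D \<and> A (x + (-1) *\<^sub>R y) = A x + A ((-1) *\<^sub>R y)"
    using assms(1,2) unfolding linear_operator_def by blast
  with m show "x - y \<in> D" "A (x - y) = A x - A y"
    by auto
qed

lemma linear_operator_scaleC:
  assumes "linear_operator D A" "x \<in> D"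
  shows "a *\<^sub>C x \<in> D" "A (a *\<^sub>C x) = a *\<^sub>C A x"
  using assms unfolding linear_operator_def by blast+

lemma linear_operator_scaleR:
  assumes "linear_operator D A" "x \<in> D"
  shows "r *\<^sub>R x \<in> D" "A (r *\<^sub>R x) = r *\<^sub>R A x"
  using assms unfolding linear_operator_def scaleR_scaleC by blast+

lemma self_adjoint_symmetric:
  assumes "self_adjoint D A" "x \<in> D" "y \<in> D"
  shows "cinner (A x) y = cinner x (A y)"
proof -
  have "(y, A y) \<in> adjoint_graph D A"
    using assms unfolding self_adjoint_def by blast
  then show ?thesis
    using assms(2) unfolding adjoint_graph_def by blast
qed

section \<open>Resolvents at real points\<close>

lemma resolvent_setE:
  assumes "of_real m \<in> resolvent_set D A"
  obtains R where "bounded_linear R" "\<And>y. R y \<in> D" "\<And>y. m *\<^sub>R R y - A (R y) = y"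
    "\<And>x. x \<in> D \<Longrightarrow> R (m *\<^sub>R x - A x) = x"
  using assms unfolding resolvent_set_def bounded_clinear_def scaleR_scaleC by blast

lemma resolvent_set_bounded_below:
  assumes "of_real m \<in> resolvent_set D A"
  obtains c where "c > 0" "\<And>x. x \<in> D \<Longrightarrow> norm x \<le> c * norm (m *\<^sub>R x - A x)"
proof -
  obtain R where R: "bounded_linear R" "\<And>x. x \<in> D \<Longrightarrow> R (m *\<^sub>R x - A x) = x"
    using resolvent_setE[OF assms] by metis
  obtain c where "c > 0" "\<And>x. norm (R x) \<le> norm x * c"
    using bounded_linear.pos_bounded[OF R(1)] by blast
  then show thesis
    using that[of c] R(2) by (metis mult.commute)
qed

text \<open>Since \<open>y + s R y = (m + s - A) (R y)\<close>, regularity of \<open>m + s\<close>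
  bounds \<open>R y\<close> by this vector, and the triangle inequality then bounds
  \<open>y\<close>.\<close>

lemma perturbed_identity_bounded_below:
  assumes R: "\<And>y. R y \<in> D" "\<And>y. m *\<^sub>R R y - A (R y) = y"
    and s: "of_real (m + s) \<in> resolvent_set D A"
  obtains d where "d > 0" "\<And>y. norm y \<le> d * norm (y + s *\<^sub>R R y)"
proof -
  obtain c where c: "c > 0" "\<And>x. x \<in> D \<Longrightarrow> norm x \<le> c * norm ((m + s) *\<^sub>R x - A x)"
    using resolvent_set_bounded_below[OF s] by blast
  have "norm y \<le> (1 + \<bar>s\<bar> * c) * norm (y + s *\<^sub>R R y)" for y
  proof -
    have "(m + s) *\<^sub>R R y - A (R y) = y + s *\<^sub>R R y"
      using R(2)[of y] by (simp add: algebra_simps)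
    then have "norm (R y) \<le> c * norm (y + s *\<^sub>R R y)"
      using c(2)[OF R(1)[of y]] by simp
    then have "\<bar>s\<bar> * norm (R y) \<le> \<bar>s\<bar> * (c * norm (y + s *\<^sub>R R y))"
      by (rule mult_left_mono) simp
    moreover have "norm y \<le> norm (y + s *\<^sub>R R y) + \<bar>s\<bar> * norm (R y)"
      using norm_triangle_ineq4[of "y + s *\<^sub>R R y" "s *\<^sub>R R y"] by simp
    ultimately show ?thesis
      by (simp add: algebra_simps)
  qed
  moreover have "1 + \<bar>s\<bar> * c > 0"
    using c(1) by (simp add: add_pos_nonneg)
  ultimately show thesis
    using that by blast
qed

text \<open>
  With \<open>R = (m - A)\<^sup>-\<^sup>1\<close> and \<open>r = \<parallel>R\<parallel> > 1 / \<epsilon>\<close>, both \<open>m \<plusminus> 1 / r\<close> are regular, so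
  \<open>1 - R\<^sup>2 / r\<^sup>2 = (1 - R / r) (1 + R / r)\<close> is bounded below. As \<open>R\<close> is symmetric, expanding
  \<open>\<parallel>y - R\<^sup>2 y / r\<^sup>2\<parallel>\<^sup>2\<close> then bounds \<open>\<parallel>R y\<parallel>\<close> by a constant smaller than \<open>r\<close> times \<open>\<parallel>y\<parallel>\<close>.
\<close>

lemma self_adjoint_resolvent_bound:
  assumes sa: "self_adjoint D A" and "\<epsilon> > 0"
    and far: "\<And>l. l \<in> spectrum D A \<Longrightarrow> \<epsilon> \<le> cmod (of_real m - l)"
    and "x \<in> D"
  shows "\<epsilon> * norm x \<le> norm (m *\<^sub>R x - A x)"
proof -
  have reg: "of_real (m + s) \<in> resolvent_set D A" if "\<bar>s\<bar> < \<epsilon>" for s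
  proof (rule ccontr)
    assume "of_real (m + s) \<notin> resolvent_set D A"
    then have "\<epsilon> \<le> cmod (of_real m - of_real (m + s))"
      by (intro far) (simp add: spectrum_def)
    also have "\<dots> = \<bar>s\<bar>"
      by (simp add: norm_minus_commute)
    finally show False
      using that by simp
  qed
  have "of_real m \<in> resolvent_set D A"
    using reg[of 0] \<open>\<epsilon> > 0\<close> by simp
  then obtain R where R: "bounded_linear R" "\<And>y. R y \<in> D" "\<And>y. m *\<^sub>R R y - A (R y) = y"
    and Rl: "\<And>x. x \<in> D \<Longrightarrow> R (m *\<^sub>R x - A x) = x"
    using resolvent_setE by metis
  interpret R: bounded_linear R by fact
  define r where "r = onorm R"
  have le: "norm (R y) \<le> r * norm y" for y
    unfolding r_def by (rule onorm[OF R(1)])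
  have Rsym: "cinner (R y) z = cinner y (R z)" for y z
  proof -
    have "cinner (R y) z = cinner (R y) (m *\<^sub>R R z - A (R z))"
      by (simp add: R(3))
    also have "\<dots> = cinner (m *\<^sub>R R y - A (R y)) (R z)"
      using self_adjoint_symmetric[OF sa R(2) R(2), of y z]
      by (simp add: cinner_diff_left cinner_diff_right cinner_scaleR_left cinner_scaleR_right)
    finally show ?thesis
      by (simp add: R(3))
  qed
  have "\<epsilon> * r \<le> 1"
  proof (rule ccontr)
    assume "\<not> \<epsilon> * r \<le> 1"
    then have "\<epsilon> * r > 1"
      by simp
    then have "r > 0"
      using \<open>\<epsilon> > 0\<close> by (metis less_trans zero_less_mult_pos zero_less_one)
    with \<open>\<epsilon> * r > 1\<close> have "1 / r < \<epsilon>"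
      by (simp add: field_simps)
    with \<open>r > 0\<close> have "\<bar>1 / r\<bar> < \<epsilon>" "\<bar>- (1 / r)\<bar> < \<epsilon>"
      by auto
    from reg[OF this(1)] reg[OF this(2)] obtain d e where
      d: "d > 0" "\<And>y. norm y \<le> d * norm (y + (1 / r) *\<^sub>R R y)" and
      e: "e > 0" "\<And>y. norm y \<le> e * norm (y + (- (1 / r)) *\<^sub>R R y)"
      using perturbed_identity_bounded_below[of R D m A, OF R(2,3)] by metis
    define k where "k = d * e"
    have "k > 0"
      using d(1) e(1) by (simp add: k_def)
    have main: "(norm (R y))\<^sup>2 \<le> r\<^sup>2 * (1 - 1 / k\<^sup>2) * (norm y)\<^sup>2" for y
    proof -
      define z where "z = y + (1 / r) *\<^sub>R R y"
      have zz: "z + (- (1 / r)) *\<^sub>R R z = y - (1 / r\<^sup>2) *\<^sub>R R (R y)"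
        by (simp add: z_def R.add R.scaleR algebra_simps power2_eq_square)
      have "norm y \<le> d * norm z"
        using d(2) by (simp add: z_def)
      also have "\<dots> \<le> d * (e * norm (y - (1 / r\<^sup>2) *\<^sub>R R (R y)))"
        using e(2)[of z] d(1) unfolding zz by simp
      finally have "(norm y)\<^sup>2 \<le> (k * norm (y - (1 / r\<^sup>2) *\<^sub>R R (R y)))\<^sup>2"
        by (intro power_mono) (auto simp: k_def)
      then have "(norm y)\<^sup>2 / k\<^sup>2 \<le> (norm (y - (1 / r\<^sup>2) *\<^sub>R R (R y)))\<^sup>2"
        using \<open>k > 0\<close> by (simp add: field_simps power_mult_distrib)
      also have "\<dots> = (norm y)\<^sup>2 - 2 * (norm (R y))\<^sup>2 / r\<^sup>2 + (norm (R (R y)) / r\<^sup>2)\<^sup>2"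
        by (simp add: norm_diff_power2 cinner_scaleR_right Rsym[symmetric] cinner_self
            power_divide)
      \<comment> \<open>Symmetry of \<open>R\<close> has turned the cross term into twice
        \<open>(norm (R y) / r)^2\<close>. The last term is at most half of that, so one copy
        survives with a minus sign.\<close>
      also have "(norm (R (R y)) / r\<^sup>2)\<^sup>2 \<le> (norm (R y) / r)\<^sup>2"
        using le[of "R y"] \<open>r > 0\<close>
        by (intro power_mono) (auto simp: field_simps power2_eq_square)
      finally have "(norm y)\<^sup>2 / k\<^sup>2 \<le> (norm y)\<^sup>2 - (norm (R y))\<^sup>2 / r\<^sup>2"
        by (simp add: power_divide)
      then have "(norm (R y))\<^sup>2 / r\<^sup>2 \<le> (1 - 1 / k\<^sup>2) * (norm y)\<^sup>2"
        by (simp add: algebra_simps)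
      then show ?thesis
        using \<open>r > 0\<close> by (simp add: pos_divide_le_eq mult_ac)
    qed
    \<comment> \<open>The sign of \<open>1 - 1 / k\<^sup>2\<close> is not known at this point;
      \<open>max 0\<close> makes \<open>q\<close> non-negative, as a bound on \<open>onorm\<close>
      must be, and still leaves \<open>q < r\<close>.\<close>
    define q where "q = sqrt (r\<^sup>2 * max 0 (1 - 1 / k\<^sup>2))"
    have "norm (R y) \<le> q * norm y" for y
    proof (rule power2_le_imp_le)
      have "(norm (R y))\<^sup>2 \<le> r\<^sup>2 * (1 - 1 / k\<^sup>2) * (norm y)\<^sup>2"
        by (rule main)
      also have "\<dots> \<le> r\<^sup>2 * max 0 (1 - 1 / k\<^sup>2) * (norm y)\<^sup>2"
        by (intro mult_right_mono mult_left_mono) auto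
      finally show "(norm (R y))\<^sup>2 \<le> (q * norm y)\<^sup>2"
        by (simp add: q_def power_mult_distrib)
    qed (simp add: q_def)
    then have "r \<le> q"
      unfolding r_def by (intro onorm_bound) (simp_all add: q_def)
    moreover have "q < sqrt (r\<^sup>2)"
      unfolding q_def real_sqrt_less_iff using \<open>r > 0\<close> \<open>k > 0\<close> by simp
    ultimately show False
      using \<open>r > 0\<close> by simp
  qed
  have "\<epsilon> * norm x \<le> \<epsilon> * (r * norm (m *\<^sub>R x - A x))"
    using le[of "m *\<^sub>R x - A x"] Rl[OF \<open>x \<in> D\<close>] \<open>\<epsilon> > 0\<close> by simp
  also have "\<dots> \<le> 1 * norm (m *\<^sub>R x - A x)"
    unfolding mult.assoc[symmetric] using \<open>\<epsilon> * r \<le> 1\<close> by (rule mult_right_mono) simp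
  finally show ?thesis
    by simp
qed

section \<open>Invariant zeros away from the eigenvalues\<close>

lemma invariant_zero_real:
  assumes "self_adjoint D A" "z \<in> invariant_zeros D A b b" "\<not> eigenvalue D A z"
  obtains m x where "z = of_real m" "x \<in> D" "m *\<^sub>R x - A x = b" "cinner x b = 0"
proof -
  obtain x0 u where x0: "x0 \<in> D" "x0 \<noteq> 0" "z *\<^sub>C x0 - A x0 = u *\<^sub>C b" "cinner x0 b = 0"
    using assms(2) unfolding invariant_zeros_def input_op_def output_op_def by auto
  have lin: "linear_operator D A"
    using assms(1) by (simp add: self_adjoint_def)
  interpret V: vector_space "scaleC :: complex \<Rightarrow> 'a \<Rightarrow> 'a"
    by (rule vector_space_scaleC)
  \<comment> \<open>With \<open>u = 0\<close> the vector \<open>x0\<close> would be an eigenvector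
    for \<open>z\<close>. A non-zero \<open>u\<close> can be scaled to 1 below.\<close>
  have "u \<noteq> 0"
    using x0 assms(3) unfolding eigenvalue_def by auto
  have "cinner b x0 = 0"
    using x0(4) by (subst cinner_commute) simp
  \<comment> \<open>Collocation enters here: the vanishing output also removes the input term, so
    \<open>z\<close> is a Rayleigh quotient of the symmetric \<open>A\<close>.\<close>
  then have "cinner (z *\<^sub>C x0 - A x0) x0 = 0"
    unfolding x0(3) by (simp add: cinner_scaleC_left)
  then have *: "z * of_real ((norm x0)\<^sup>2) = cinner (A x0) x0"
    by (simp add: cinner_diff_left cinner_scaleC_left cinner_self)
  have "cnj (cinner (A x0) x0) = cinner (A x0) x0"
    using self_adjoint_symmetric[OF assms(1) x0(1) x0(1)] cinner_commute by metis
  then have "Im (cinner (A x0) x0) = 0"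
    by (simp add: complex_eq_iff)
  then have "Im z * (norm x0)\<^sup>2 = 0"
    using arg_cong[OF *, of Im] by simp
  then have z: "z = of_real (Re z)"
    using x0(2) by (simp add: complex_eq_iff)
  define x where "x = (1 / u) *\<^sub>C x0"
  have "x \<in> D" and A: "A x = (1 / u) *\<^sub>C A x0"
    using linear_operator_scaleC[OF lin x0(1)] by (simp_all add: x_def)
  have "Re z *\<^sub>R x - A x = z *\<^sub>C x - A x"
    using z by (metis scaleR_scaleC)
  also have "\<dots> = (1 / u) *\<^sub>C (z *\<^sub>C x0 - A x0)"
    unfolding A unfolding x_def V.scale_right_diff_distrib scaleC_scaleC
    by (simp only: mult.commute)
  also have "\<dots> = b"
    using \<open>u \<noteq> 0\<close> by (simp add: x0(3))
  finally have "Re z *\<^sub>R x - A x = b" .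
  moreover have "cinner x b = 0"
    by (simp add: x_def cinner_scaleC_left x0(4))
  ultimately show thesis
    using that z \<open>x \<in> D\<close> by blast
qed

lemma zeros_separated:
  assumes sa: "self_adjoint D A" and "b \<noteq> 0"
    and bd: "\<And>x. x \<in> D \<Longrightarrow> \<epsilon> * norm x \<le> norm (m *\<^sub>R x - A x)"
    and x: "x \<in> D" "m *\<^sub>R x - A x = b" "cinner x b = 0"
    and y: "y \<in> D" "n *\<^sub>R y - A y = b" "cinner y b = 0"
    and "m \<noteq> n" "\<epsilon> > 0"
  shows "\<epsilon> \<le> \<bar>m - n\<bar>"
proof -
  have lin: "linear_operator D A"
    using sa by (simp add: self_adjoint_def)
  have "y \<noteq> 0"
    using y(2) \<open>b \<noteq> 0\<close> linear_operator_scaleR(2)[OF lin y(1), of 0] by auto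
  have by0: "cinner b y = 0"
    using y(3) by (subst cinner_commute) simp
  \<comment> \<open>Both sides are 0, being \<open>cinner b y\<close> and \<open>cinner x b\<close>.
    Moving \<open>A\<close> across leaves \<open>(m - n) * cinner x y = 0\<close>.\<close>
  have "cinner (m *\<^sub>R x - A x) y = cinner x (n *\<^sub>R y - A y)"
    by (simp add: x y by0)
  then have "of_real (m - n) * cinner x y = 0"
    using self_adjoint_symmetric[OF sa x(1) y(1)]
    by (simp add: cinner_diff_left cinner_diff_right cinner_scaleR_left cinner_scaleR_right
        algebra_simps)
  then have "cinner x y = 0"
    using \<open>m \<noteq> n\<close> by simp
  then have "(norm y)\<^sup>2 \<le> (norm (x - y))\<^sup>2"
    by (simp add: norm_diff_power2)
  then have "norm y \<le> norm (x - y)"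
    by (rule power2_le_imp_le) simp
  then have "\<epsilon> * norm y \<le> \<epsilon> * norm (x - y)"
    using \<open>\<epsilon> > 0\<close> by simp
  also have "\<dots> \<le> norm (m *\<^sub>R (x - y) - A (x - y))"
    using bd linear_operator_diff(1)[OF lin x(1) y(1)] by blast
  \<comment> \<open>The two inputs are the same \<open>b\<close> and cancel, leaving a multiple of
    \<open>y\<close>.\<close>
  also have "m *\<^sub>R (x - y) - A (x - y) = (m *\<^sub>R x - A x) - (n *\<^sub>R y - A y) + (n - m) *\<^sub>R y"
    using linear_operator_diff(2)[OF lin x(1) y(1)] by (simp add: algebra_simps)
  also have "norm \<dots> = \<bar>m - n\<bar> * norm y"
    by (simp add: x(2) y(2) abs_minus_commute)
  finally show ?thesis
    using \<open>y \<noteq> 0\<close> by simp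
qed

text \<open>Passing from \<open>x\<close> to \<open>w = S x\<close> replaces
  \<open>cinner x b = 0\<close> by a pairing with the fixed value \<open>(norm b)^2\<close>. A fixed
  \<open>y0\<close> in \<open>D\<close> near \<open>S b\<close> keeps at least half of it, while
  \<open>m * cinner w y0\<close> stays bounded because \<open>A\<close> can be moved to
  \<open>y0\<close>. Hence one \<open>K\<close> serves all these zeros.\<close>

lemma zeros_bounded:
  assumes sa: "self_adjoint D A" and "b \<noteq> 0" "\<epsilon> > 0"
    and b: "b \<in> sqrt_domain D (\<lambda>x. - A x)"
  obtains K where "\<And>m x. (\<And>v. v \<in> D \<Longrightarrow> \<epsilon> * norm v \<le> norm (m *\<^sub>R v - A v)) \<Longrightarrow>
    x \<in> D \<Longrightarrow> m *\<^sub>R x - A x = b \<Longrightarrow> cinner x b = 0 \<Longrightarrow> \<bar>m\<bar> \<le> K"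
proof -
  obtain E S where ES: "self_adjoint E S" "D = {x \<in> E. S x \<in> E}" "\<And>x. x \<in> D \<Longrightarrow> S (S x) = - A x"
    and "b \<in> E"
    using b unfolding sqrt_domain_def positive_sqrt_def by auto
  have lin: "linear_operator E S"
    using ES(1) by (simp add: self_adjoint_def)
  define y where "y = S b"
  define \<beta> where "\<beta> = (norm b)\<^sup>2"
  have "\<beta> > 0"
    using \<open>b \<noteq> 0\<close> by (simp add: \<beta>_def)
  \<comment> \<open>Chosen so that \<open>norm y / \<epsilon> * \<delta> \<le> \<beta> / 2\<close>,
    where \<open>norm y / \<epsilon>\<close> will bound \<open>norm w\<close>; the
    \<open>+ 1\<close> keeps the denominator positive without a case split on
    \<open>y\<close>.\<close>
  define \<delta> where "\<delta> = \<beta> * \<epsilon> / (2 * (norm y + 1))"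
  have ny: "norm y + 1 > 0"
    by (rule add_nonneg_pos) simp_all
  then have "\<delta> > 0"
    using \<open>\<beta> > 0\<close> \<open>\<epsilon> > 0\<close> unfolding \<delta>_def
    by simp
  have "y \<in> closure D"
    using sa by (simp add: self_adjoint_def)
  then obtain y0 where y0: "y0 \<in> D" "norm (y - y0) < \<delta>"
    using \<open>\<delta> > 0\<close> unfolding closure_approachable by (metis dist_norm norm_minus_commute)
  define K where "K = 2 * (norm y / \<epsilon> * norm (A y0) + norm y * norm y0) / \<beta>"
  show thesis
  proof (rule that[of K])
    fix m x
    assume bd: "\<And>v. v \<in> D \<Longrightarrow> \<epsilon> * norm v \<le> norm (m *\<^sub>R v - A v)"
      and x: "x \<in> D" "m *\<^sub>R x - A x = b" "cinner x b = 0"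
    have xE: "x \<in> E" "S x \<in> E"
      using x(1) ES(2) by auto
    have SSx: "S (S x) = b - m *\<^sub>R x"
      using ES(3)[OF x(1)] x(2) by (simp add: algebra_simps)
    define w where "w = S x"
    \<comment> \<open>As \<open>b\<close> lies in \<open>E\<close>, so does
      \<open>S (S x) = b - m x\<close>; thus \<open>w\<close> is in the domain of the square of
      \<open>S\<close>, which is exactly \<open>D\<close>. Applying \<open>S\<close> to the equation
      for \<open>x\<close> gives the one for \<open>w\<close>.\<close>
    have "b - m *\<^sub>R x \<in> E" and S3: "S (b - m *\<^sub>R x) = y - m *\<^sub>R w"
      using linear_operator_diff[OF lin \<open>b \<in> E\<close>] linear_operator_scaleR[OF lin xE(1)]
      by (auto simp: y_def w_def)
    then have "w \<in> D"
      using ES(2) xE SSx by (simp add: w_def)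
    have mw: "m *\<^sub>R w - A w = y"
      using ES(3)[OF \<open>w \<in> D\<close>] S3 SSx by (simp add: w_def algebra_simps)
    have "cinner w y = cinner (S (S x)) b"
      using self_adjoint_symmetric[OF ES(1) xE(2) \<open>b \<in> E\<close>] by (simp add: w_def y_def)
    then have wy: "Re (cinner w y) = \<beta>"
      by (simp add: SSx cinner_diff_left cinner_scaleR_left x(3) cinner_self \<beta>_def)
    have nw: "norm w \<le> norm y / \<epsilon>"
      using bd[OF \<open>w \<in> D\<close>] mw \<open>\<epsilon> > 0\<close> by (simp add: field_simps)
    have "Re (cinner w (y - y0)) \<le> norm w * norm (y - y0)"
      by (rule Re_cinner_le)
    also have "\<dots> \<le> norm y / \<epsilon> * \<delta>"
      using nw y0(2) by (intro mult_mono) (auto intro: order_trans[OF norm_ge_zero])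
    also have "\<dots> = \<beta> / 2 * (norm y / (norm y + 1))"
      using \<open>\<epsilon> > 0\<close> by (simp add: \<delta>_def)
    also have "\<dots> \<le> \<beta> / 2 * 1"
      using \<open>\<beta> > 0\<close> ny by (intro mult_left_mono) simp_all
    finally have half: "\<beta> / 2 \<le> Re (cinner w y0)"
      by (simp add: cinner_diff_right wy)
    have "m *\<^sub>R w = A w + y"
      using mw by (simp add: algebra_simps)
    then have mult: "of_real m * cinner w y0 = cinner w (A y0) + cinner y y0"
      using self_adjoint_symmetric[OF sa \<open>w \<in> D\<close> y0(1)]
      by (metis cinner_add_left cinner_scaleR_left)
    have eq: "m * Re (cinner w y0) = Re (cinner w (A y0)) + Re (cinner y y0)"
      using arg_cong[OF mult, of Re] by simp
    have abs_le: "\<bar>Re (cinner v v')\<bar> \<le> norm v * norm v'" for v v' :: 'a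
      using Re_cinner_le[of v v'] Re_cinner_le[of "- v" v'] by (simp add: cinner_minus_left)
    have "\<bar>m\<bar> * (\<beta> / 2) \<le> \<bar>m\<bar> * Re (cinner w y0)"
      using half by (rule mult_left_mono) simp
    also have "\<dots> = \<bar>m * Re (cinner w y0)\<bar>"
      using half \<open>\<beta> > 0\<close> by (simp add: abs_mult)
    also have "\<dots> \<le> norm w * norm (A y0) + norm y * norm y0"
      unfolding eq using abs_le[of w "A y0"] abs_le[of y y0] by linarith
    also have "\<dots> \<le> norm y / \<epsilon> * norm (A y0) + norm y * norm y0"
      by (intro add_right_mono mult_right_mono nw) simp
    finally show "\<bar>m\<bar> \<le> K"
      using \<open>\<beta> > 0\<close> by (simp add: K_def field_simps)
  qed
qed

section \<open>Finiteness of the exceptional zeros\<close>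

lemma finite_if_bounded_separated:
  fixes Z :: "'a::heine_borel set"
  assumes "bounded Z" "\<epsilon> > 0"
    and sep: "\<And>x y. x \<in> Z \<Longrightarrow> y \<in> Z \<Longrightarrow> x \<noteq> y \<Longrightarrow> \<epsilon> \<le> dist x y"
  shows "finite Z"
proof (rule ccontr)
  assume "infinite Z"
  then obtain p where "p islimpt Z"
    using bounded_infinite_imp_islimpt[OF subset_refl assms(1)] by blast
  \<comment> \<open>Radius \<open>\<epsilon> / 2\<close> forces any two points of \<open>Z\<close>
    in the ball to be closer than \<open>\<epsilon>\<close>; infinitely many points provide two
    distinct ones.\<close>
  then have inf: "infinite (Z \<inter> ball p (\<epsilon> / 2))"
    using \<open>\<epsilon> > 0\<close> by (simp add: islimpt_eq_infinite_ball)
  obtain x where x: "x \<in> Z \<inter> ball p (\<epsilon> / 2)"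
    using infinite_imp_nonempty[OF inf] by blast
  from inf have "infinite (Z \<inter> ball p (\<epsilon> / 2) - {x})"
    by simp
  from infinite_imp_nonempty[OF this]
  obtain y where y: "y \<in> Z \<inter> ball p (\<epsilon> / 2)" "y \<noteq> x"
    by blast
  have "dist x y < \<epsilon>"
    using x y by (simp add: dist_triangle_half_r[of p])
  then show False
    using sep[of x y] x y by auto
qed

text \<open>The index set \<open>I\<close> may be any set of naturals, so that finite and infinite
  sets of zeros are treated alike.\<close>

theorem theorem5p3:
  fixes D :: "'a::chilbert_space set" and A :: "'a \<Rightarrow> 'a" and b c :: 'a
    and I :: "nat set" and \<mu> :: "nat \<Rightarrow> complex" and \<epsilon> :: real
  assumes "control_system D A b c"
    and "minimal_system D A b c"
    and "collocated_self_adjoint D A b c"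
    and "negative_semidefinite D A"
    and "b \<in> sqrt_domain D (\<lambda>x. - A x)"
    and "bij_betw \<mu> I (invariant_zeros D A b c)"
    and "\<epsilon> > 0"
  shows "\<exists>N. \<forall>n\<in>I. n \<ge> N \<longrightarrow> (\<exists>l. eigenvalue D A l \<and> cmod (\<mu> n - l) < \<epsilon>)"
proof -
  have sa: "self_adjoint D A" and "c = b"
    using assms(3) by (auto simp: collocated_self_adjoint_def)
  interpret V: vector_space "scaleC :: complex \<Rightarrow> 'a \<Rightarrow> 'a"
    by (rule vector_space_scaleC)
  have "b \<noteq> 0"
    using assms(1) by (auto simp: control_system_def input_op_def fun_eq_iff)
  have spec: "eigenvalue D A l" if "l \<in> spectrum D A" for l
    using assms(1) that by (auto simp: control_system_def)
  \<comment> \<open>These are the zeros violating the claim for \<open>\<epsilon>\<close>. As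
    \<open>\<mu>\<close> is injective on \<open>I\<close>, finiteness of \<open>Z\<close> leaves
    only finitely many bad indices.\<close>
  define Z where
    "Z = {z \<in> invariant_zeros D A b b. \<forall>l. eigenvalue D A l \<longrightarrow> \<epsilon> \<le> cmod (z - l)}"
  have ex: "\<exists>m x. z = of_real m \<and> x \<in> D \<and> m *\<^sub>R x - A x = b \<and> cinner x b = 0 \<and>
      (\<forall>v\<in>D. \<epsilon> * norm v \<le> norm (m *\<^sub>R v - A v))" if "z \<in> Z" for z
  proof -
    have "\<not> eigenvalue D A z"
      using that \<open>\<epsilon> > 0\<close> by (auto simp: Z_def)
    then obtain m x where mx: "z = of_real m" "x \<in> D" "m *\<^sub>R x - A x = b" "cinner x b = 0"
      using invariant_zero_real[OF sa] \<open>z \<in> Z\<close> unfolding Z_def by blast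
    \<comment> \<open>The resolvent bound asks for distance from the whole spectrum; by
      \<open>spec\<close> distance from the eigenvalues is enough.\<close>
    have "\<epsilon> * norm v \<le> norm (m *\<^sub>R v - A v)" if "v \<in> D" for v
      using \<open>z \<in> Z\<close> spec mx(1)
      by (intro self_adjoint_resolvent_bound[OF sa \<open>\<epsilon> > 0\<close> _ that]) (auto simp: Z_def)
    then show ?thesis
      using mx by blast
  qed
  have "finite Z"
  proof (rule finite_if_bounded_separated[OF _ \<open>\<epsilon> > 0\<close>])
    obtain K where K: "\<And>m x. (\<And>v. v \<in> D \<Longrightarrow> \<epsilon> * norm v \<le> norm (m *\<^sub>R v - A v)) \<Longrightarrow>
        x \<in> D \<Longrightarrow> m *\<^sub>R x - A x = b \<Longrightarrow> cinner x b = 0 \<Longrightarrow> \<bar>m\<bar> \<le> K"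
      using zeros_bounded[OF sa \<open>b \<noteq> 0\<close> \<open>\<epsilon> > 0\<close> assms(5)] by blast
    have "norm z \<le> K" if "z \<in> Z" for z
      using ex[OF that] K by fastforce
    then show "bounded Z"
      by (rule boundedI)
  next
    fix z z' assume "z \<in> Z" "z' \<in> Z" "z \<noteq> z'"
    obtain m x where z: "z = of_real m" "x \<in> D" "m *\<^sub>R x - A x = b" "cinner x b = 0"
      "\<And>v. v \<in> D \<Longrightarrow> \<epsilon> * norm v \<le> norm (m *\<^sub>R v - A v)"
      using ex[OF \<open>z \<in> Z\<close>] by blast
    obtain n y where z': "z' = of_real n" "y \<in> D" "n *\<^sub>R y - A y = b" "cinner y b = 0"
      using ex[OF \<open>z' \<in> Z\<close>] by blast
    have "\<epsilon> \<le> \<bar>m - n\<bar>"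
      using zeros_separated[OF sa \<open>b \<noteq> 0\<close> z(5) z(2-4) z'(2-4)] \<open>z \<noteq> z'\<close> z(1) z'(1) \<open>\<epsilon> > 0\<close>
      by blast
    then show "\<epsilon> \<le> dist z z'"
      unfolding z(1) z'(1) dist_of_real by (simp add: dist_real_def)
  qed
  moreover have "inj_on \<mu> I" and img: "\<mu> ` I = invariant_zeros D A b b"
    using assms(6) \<open>c = b\<close> by (auto simp: bij_betw_def)
  ultimately have "finite {n \<in> I. \<mu> n \<in> Z}"
    using finite_vimage_IntI[of Z \<mu> I] by (simp add: vimage_def Int_def conj_commute)
  then obtain N where N: "\<And>n. n \<in> I \<Longrightarrow> \<mu> n \<in> Z \<Longrightarrow> n < N"
    using finite_nat_set_iff_bounded by (metis (mono_tags, lifting) mem_Collect_eq)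
  show ?thesis
  proof (intro exI[of _ N] ballI impI)
    fix n assume "n \<in> I" "N \<le> n"
    then have "\<mu> n \<notin> Z" "\<mu> n \<in> invariant_zeros D A b b"
      using N img by (auto simp: not_less[symmetric])
    then show "\<exists>l. eigenvalue D A l \<and> cmod (\<mu> n - l) < \<epsilon>"
      by (auto simp: Z_def not_le)
  qed
qed

end
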